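(* Let $r\ge1$. There exists a constant $C_r$ such that the following holds. Let $n\ge 3r$, $\lambda\vdash n$ with $n-\lambda_1=r$, and $\sigma\in\mathfrak{S}_n$ with $f:=f_1(\sigma)\ge 2r$; let $\alpha$ be the cycle lengths of $\sigma$ listed in weakly increasing order. Let $\mu\vdash f$ with $\mu\subset\lambda$, let $K=|\lambda^*\setminus\mu^*|$ and assume $K\ge2$. Let $s=(s_i)_{i\ge2}$ be nonnegative integers with $\sum_{i\ge2} i s_i=K$. Let $S(\lambda,\alpha,\mu,s)$ be the set of ribbon tableaux of shape $\lambda$ and weight $\alpha$ in which the ribbons of length $1$ fill exactly the cells of $\mu$, and the cells of $\lambda^*\setminus\mu^*$ are covered by exactly $s_i$ ribbons of length $i$ for each $i\ge2$. Then $$|S(\lambda,\alpha,\mu,s)|\le C_r\, f^{r-K}\,G(\sigma)^K\le C_r\,M(\sigma)^r.$$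
   Context: A ribbon (rim hook) is a connected skew Young diagram containing no $2\times2$ square; its height is its number of rows minus one. A ribbon tableau of shape $\lambda\vdash n$ and weight $\alpha=(\alpha_1,\dots,\alpha_p)$ (a sequence of positive integers summing to $n$) is a chain of Young diagrams $\emptyset=\lambda^{(0)}\subset\lambda^{(1)}\subset\cdots\subset\lambda^{(p)}=\lambda$ such that each $\lambda^{(i)}\setminus\lambda^{(i-1)}$ is a ribbon with $\alpha_i$ cells; its height is the sum of the heights of its ribbons. $\lambda_1$ is the first row length of $\lambda$ and $\lambda^*=(\lambda_2,\lambda_3,\dots)$; for $\mu\subset\lambda$, $\lambda^*\setminus\mu^*$ is the set of cells of $\lambda\setminus\mu$ not in the first row. $f_i(\sigma)$ is the number of $i$-cycles of $\sigma$, $M(\sigma)=\max_{i\ge1}f_i(\sigma)^{1/i}$ and $G(\sigma)=\max_{i\ge2}f_i(\sigma)^{1/i}$. *)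

theory Defs
  imports Complex_Main "HOL-Library.Multiset" "HOL-Combinatorics.Permutations"
begin

text \<open>Partitions are lists of positive naturals, weakly decreasing.
 Cells are (row, column), 0-indexed; row 0 is the first row.\<close>

definition is_partition :: "nat list \<Rightarrow> bool" where
  "is_partition lam \<longleftrightarrow> sorted_wrt (\<ge>) lam \<and> (\<forall>x\<in>set lam. 0 < x)"

definition partition_of :: "nat list \<Rightarrow> nat \<Rightarrow> bool" where
  "partition_of lam n \<longleftrightarrow> is_partition lam \<and> sum_list lam = n"

definition diag :: "nat list \<Rightarrow> (nat \<times> nat) set" where
  "diag lam = {(i, j). i < length lam \<and> j < lam ! i}"

definition first_row :: "nat list \<Rightarrow> nat" where
  "first_row lam = (if lam = [] then 0 else hd lam)"

definition cell_adj :: "nat \<times> nat \<Rightarrow> nat \<times> nat \<Rightarrow> bool" where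
  "cell_adj a b \<longleftrightarrow>
     (fst a = fst b \<and> (snd b = Suc (snd a) \<or> snd a = Suc (snd b))) \<or>
     (snd a = snd b \<and> (fst b = Suc (fst a) \<or> fst a = Suc (fst b)))"

definition cells_connected :: "(nat \<times> nat) set \<Rightarrow> bool" where
  "cells_connected R \<longleftrightarrow> R \<noteq> {} \<and>
     (\<forall>a\<in>R. \<forall>b\<in>R. (\<lambda>x y. x \<in> R \<and> y \<in> R \<and> cell_adj x y)\<^sup>*\<^sup>* a b)"

definition no_square :: "(nat \<times> nat) set \<Rightarrow> bool" where
  "no_square R \<longleftrightarrow> \<not> (\<exists>i j. (i, j) \<in> R \<and> (Suc i, j) \<in> R \<and> (i, Suc j) \<in> R \<and> (Suc i, Suc j) \<in> R)"

text \<open>A ribbon: connected skew shape with no 2x2 square (skewness comes from the chain).\<close>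
definition ribbon :: "(nat \<times> nat) set \<Rightarrow> bool" where
  "ribbon R \<longleftrightarrow> cells_connected R \<and> no_square R"

definition ribbon_tableau :: "nat list \<Rightarrow> nat list \<Rightarrow> nat list list \<Rightarrow> bool" where
  "ribbon_tableau lam alpha T \<longleftrightarrow>
     length T = Suc (length alpha) \<and> T ! 0 = [] \<and> T ! length alpha = lam \<and>
     (\<forall>k\<le>length alpha. is_partition (T ! k)) \<and>
     (\<forall>k<length alpha. diag (T ! k) \<subseteq> diag (T ! Suc k) \<and>
        ribbon (diag (T ! Suc k) - diag (T ! k)) \<and>
        card (diag (T ! Suc k) - diag (T ! k)) = alpha ! k)"

definition rib :: "nat list list \<Rightarrow> nat \<Rightarrow> (nat \<times> nat) set" where
  "rib T k = diag (T ! Suc k) - diag (T ! k)"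

text \<open>Cells of lambda* \ mu*: cells of lambda \ mu not in the first row.\<close>
definition lower_skew :: "nat list \<Rightarrow> nat list \<Rightarrow> (nat \<times> nat) set" where
  "lower_skew lam mu = {c \<in> diag lam - diag mu. 1 \<le> fst c}"

definition S_set :: "nat list \<Rightarrow> nat list \<Rightarrow> nat list \<Rightarrow> (nat \<Rightarrow> nat) \<Rightarrow> nat list list set" where
  "S_set lam alpha mu s = {T. ribbon_tableau lam alpha T \<and>
     \<Union>{rib T k | k. k < length alpha \<and> alpha ! k = 1} = diag mu \<and>
     (\<forall>k<length alpha. rib T k \<inter> lower_skew lam mu \<noteq> {} \<longrightarrow> rib T k \<subseteq> lower_skew lam mu) \<and>
     (\<forall>i\<ge>2. card {k. k < length alpha \<and> alpha ! k = i \<and> rib T k \<inter> lower_skew lam mu \<noteq> {}} = s i)}"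

definition orb :: "(nat \<Rightarrow> nat) \<Rightarrow> nat \<Rightarrow> nat set" where
  "orb \<sigma> x = {(\<sigma> ^^ k) x | k. True}"

definition cycles_of :: "(nat \<Rightarrow> nat) \<Rightarrow> nat \<Rightarrow> nat set set" where
  "cycles_of \<sigma> n = {orb \<sigma> x | x. x < n}"

definition fcyc :: "(nat \<Rightarrow> nat) \<Rightarrow> nat \<Rightarrow> nat \<Rightarrow> nat" where
  "fcyc \<sigma> n i = card {c \<in> cycles_of \<sigma> n. card c = i}"

definition cycle_type :: "(nat \<Rightarrow> nat) \<Rightarrow> nat \<Rightarrow> nat list" where
  "cycle_type \<sigma> n = sorted_list_of_multiset (image_mset card (mset_set (cycles_of \<sigma> n)))"

definition Mfun :: "(nat \<Rightarrow> nat) \<Rightarrow> nat \<Rightarrow> real" where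
  "Mfun \<sigma> n = (SUP i\<in>{1..}. real (fcyc \<sigma> n i) powr (1 / real i))"

definition Gfun :: "(nat \<Rightarrow> nat) \<Rightarrow> nat \<Rightarrow> real" where
  "Gfun \<sigma> n = (SUP i\<in>{2..}. real (fcyc \<sigma> n i) powr (1 / real i))"

end

theory Submission
  imports Defs "HOL-Library.FuncSet" "HOL-Library.Disjoint_Sets"
begin

(* A tableau T in S(lambda, alpha, mu, s) is determined by the steps at which the part of its
   shape below the first row changes, together with the new lower parts at those steps: the
   first-row lengths are then forced by the weight. Each such step adds a ribbon meeting the
   rows below the first, and these ribbons are disjoint, so there are at most r of them. Those of
   length 1 lie in mu*, so there are at most r - K of them; the others meet lambda* \ mu*, hence
   have some length i <= K, and there are at most s_i of each length i. Every lower part is a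
   partition of at most r, so it ranges over a finite set depending only on r. Choosing the
   change steps among the f fixed points and the f_i i-cycles of sigma leaves at most
   2^r f^(r-K) prod_i f_i^(s_i) <= 2^r f^(r-K) G^K possibilities, since f_i <= G^i. *)

section \<open>Young diagrams\<close>

definition lower_rows :: "(nat \<times> nat) set" where
  "lower_rows = {c. 0 < fst c}"

lemma lower_skew_eq: "lower_skew lam mu = diag lam \<inter> lower_rows - diag mu"
  by (auto simp: lower_skew_def lower_rows_def)

lemma mem_diag: "(i, j) \<in> diag P \<longleftrightarrow> i < length P \<and> j < P ! i"
  by (simp add: diag_def)

lemma diag_Nil [simp]: "diag [] = {}"
  by (simp add: diag_def)

lemma diag_Cons: "diag (x # xs) = Pair 0 ` {..<x} \<union> apfst Suc ` diag xs"
  by (auto simp: diag_def image_iff less_Suc_eq_0_disj)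

lemma card_apfst_Suc_image: "card (apfst Suc ` A) = card (A :: (nat \<times> 'a) set)"
  by (rule card_image) (simp add: inj_on_def apfst_def map_prod_def split: prod.splits)

lemma finite_diag [simp]: "finite (diag P)"
  by (induction P) (simp_all add: diag_Cons)

lemma card_diag: "card (diag P) = sum_list P"
proof (induction P)
  case (Cons x xs)
  have "card (diag (x # xs)) = card (Pair (0::nat) ` {..<x}) + card (apfst Suc ` diag xs)"
    unfolding diag_Cons by (subst card_Un_disjoint) auto
  also have "\<dots> = x + sum_list xs"
    using Cons.IH by (simp add: card_image card_apfst_Suc_image inj_on_def)
  finally show ?case by simp
qed simp

lemma diag_Int_lower_rows: "diag P \<inter> lower_rows = apfst Suc ` diag (tl P)"
  by (cases P) (auto simp: diag_Cons lower_rows_def)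

lemma card_diag_Int_lower_rows: "card (diag P \<inter> lower_rows) = sum_list (tl P)"
  by (simp add: diag_Int_lower_rows card_apfst_Suc_image card_diag)

lemma sum_list_tl: "sum_list (tl lam) = sum_list lam - first_row lam"
  by (cases lam) (simp_all add: first_row_def)

lemma diag_inject:
  assumes "\<forall>x\<in>set P. 0 < x" "\<forall>x\<in>set P'. 0 < x" "diag P = diag P'"
  shows "P = P'"
proof -
  have "i < length P \<longleftrightarrow> i < length P'" for i
    using assms by (metis mem_diag nth_mem)
  then have len: "length P = length P'"
    by (meson linorder_neqE_nat less_irrefl)
  have "j < P ! i \<longleftrightarrow> j < P' ! i" if "i < length P" for i j
    using assms(3) that len by (metis mem_diag)
  then show ?thesis
    using len by (metis nth_equalityI linorder_neqE_nat less_irrefl)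
qed

lemma is_partition_tl: "is_partition P \<Longrightarrow> is_partition (tl P)"
  by (cases P) (simp_all add: is_partition_def)

lemma tl_eq_if_diag_Int_lower_rows_eq:
  assumes "is_partition P" "is_partition P'" "diag P \<inter> lower_rows = diag P' \<inter> lower_rows"
  shows "tl P = tl P'"
proof (rule diag_inject)
  show "diag (tl P) = diag (tl P')"
    using assms(3) by (simp add: diag_Int_lower_rows inj_image_eq_iff inj_def)
qed (use is_partition_tl[OF assms(1)] is_partition_tl[OF assms(2)] in \<open>simp_all add: is_partition_def\<close>)

lemma partition_eqI:
  assumes "is_partition P" "is_partition P'" "tl P = tl P'" "sum_list P = sum_list P'"
  shows "P = P'"
  using assms by (cases P; cases P') (auto simp: is_partition_def)

section \<open>Ribbon tableaux\<close>

lemma ribbon_tableau_is_partition: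
  "ribbon_tableau lam alpha T \<Longrightarrow> k \<le> length alpha \<Longrightarrow> is_partition (T ! k)"
  by (simp add: ribbon_tableau_def)

lemma ribbon_tableau_diag_Suc:
  "ribbon_tableau lam alpha T \<Longrightarrow> k < length alpha \<Longrightarrow> diag (T ! Suc k) = diag (T ! k) \<union> rib T k"
  by (auto simp: ribbon_tableau_def rib_def)

lemma ribbon_tableau_diag_mono:
  assumes "ribbon_tableau lam alpha T" "a \<le> b" "b \<le> length alpha"
  shows "diag (T ! a) \<subseteq> diag (T ! b)"
  using assms(2,3) by (induction b rule: dec_induct) (auto simp: ribbon_tableau_diag_Suc[OF assms(1)])

lemma ribbon_tableau_diag_subset:
  assumes "ribbon_tableau lam alpha T" "k \<le> length alpha"
  shows "diag (T ! k) \<subseteq> diag lam"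
  using ribbon_tableau_diag_mono[OF assms(1), of k "length alpha"] assms
  by (simp add: ribbon_tableau_def)

lemma rib_subset_diag:
  "ribbon_tableau lam alpha T \<Longrightarrow> k < length alpha \<Longrightarrow> rib T k \<subseteq> diag lam"
  using ribbon_tableau_diag_subset[of lam alpha T "Suc k"] by (auto simp: rib_def)

lemma card_rib: "ribbon_tableau lam alpha T \<Longrightarrow> k < length alpha \<Longrightarrow> card (rib T k) = alpha ! k"
  by (simp add: ribbon_tableau_def rib_def)

lemma rib_nonempty: "ribbon_tableau lam alpha T \<Longrightarrow> k < length alpha \<Longrightarrow> rib T k \<noteq> {}"
  by (simp add: ribbon_tableau_def rib_def ribbon_def cells_connected_def)

lemma ribbon_tableau_weight_pos:
  assumes "ribbon_tableau lam alpha T" "k < length alpha"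
  shows "0 < alpha ! k"
  using card_rib[OF assms] rib_nonempty[OF assms] card_gt_0_iff[of "rib T k"]
  by (simp add: rib_def)

lemma disjoint_family_on_rib:
  assumes "ribbon_tableau lam alpha T"
  shows "disjoint_family_on (rib T) {..<length alpha}"
proof -
  have disj: "rib T j \<inter> rib T k = {}" "rib T k \<inter> rib T j = {}" if "j < k" "k < length alpha" for j k
    using ribbon_tableau_diag_mono[OF assms, of "Suc j" k] that by (auto simp: rib_def)
  show ?thesis
    unfolding disjoint_family_on_def
  proof (intro ballI impI)
    fix j k
    assume "j \<in> {..<length alpha}" "k \<in> {..<length alpha}" "j \<noteq> k"
    then show "rib T j \<inter> rib T k = {}"
      by (cases j k rule: linorder_cases) (simp_all add: disj)
  qed
qed

lemma sum_list_ribbon_tableau_nth: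
  assumes "ribbon_tableau lam alpha T" "k \<le> length alpha"
  shows "sum_list (T ! k) = sum_list (take k alpha)"
  using assms(2)
proof (induction k)
  case 0
  then show ?case using assms(1) by (simp add: ribbon_tableau_def)
next
  case (Suc k)
  have "card (diag (T ! Suc k)) = card (diag (T ! k)) + card (rib T k)"
    unfolding ribbon_tableau_diag_Suc[OF assms(1) Suc_le_lessD[OF Suc.prems]]
    by (rule card_Un_disjoint) (auto simp: rib_def)
  then show ?case
    using Suc assms(1) by (simp add: card_diag card_rib take_Suc_conv_app_nth)
qed

lemma ribbon_tableau_eqI:
  assumes T: "ribbon_tableau lam alpha T" and T': "ribbon_tableau lam alpha T'"
    and tl_eq: "\<And>k. k \<le> length alpha \<Longrightarrow> tl (T ! k) = tl (T' ! k)"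
  shows "T = T'"
proof (rule nth_equalityI)
  show "length T = length T'"
    using T T' by (simp add: ribbon_tableau_def)
  fix k
  assume "k < length T"
  then have k: "k \<le> length alpha"
    using T by (simp add: ribbon_tableau_def)
  show "T ! k = T' ! k"
    by (rule partition_eqI[OF ribbon_tableau_is_partition[OF T k]
          ribbon_tableau_is_partition[OF T' k] tl_eq[OF k]])
      (simp add: sum_list_ribbon_tableau_nth[OF T k] sum_list_ribbon_tableau_nth[OF T' k])
qed

lemma sum_list_tl_ribbon_tableau_nth_le:
  assumes "ribbon_tableau lam alpha T" "k \<le> length alpha"
  shows "sum_list (tl (T ! k)) \<le> sum_list (tl lam)"
proof -
  have "diag (T ! k) \<inter> lower_rows \<subseteq> diag lam \<inter> lower_rows"
    using ribbon_tableau_diag_subset[OF assms] by blast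
  from card_mono[OF _ this] show ?thesis
    by (simp add: card_diag_Int_lower_rows)
qed

lemma rib_meets_lower_rows_if_tl_changes:
  assumes "ribbon_tableau lam alpha T" "k < length alpha" "tl (T ! Suc k) \<noteq> tl (T ! k)"
  shows "rib T k \<inter> lower_rows \<noteq> {}"
proof
  assume "rib T k \<inter> lower_rows = {}"
  then have "diag (T ! Suc k) \<inter> lower_rows = diag (T ! k) \<inter> lower_rows"
    using ribbon_tableau_diag_Suc[OF assms(1,2)] by blast
  then show False
    using tl_eq_if_diag_Int_lower_rows_eq[OF ribbon_tableau_is_partition[OF assms(1), of "Suc k"]
        ribbon_tableau_is_partition[OF assms(1), of k]] assms(2,3)
    by simp
qed

section \<open>Elementary counting\<close>

definition changes :: "(nat \<Rightarrow> 'a) \<Rightarrow> nat \<Rightarrow> nat set" where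
  "changes a m = {k. k < m \<and> a (Suc k) \<noteq> a k}"

lemma eq_if_changes_eq:
  assumes "a 0 = b 0" "changes a m = changes b m"
    and "\<And>k. k \<in> changes a m \<Longrightarrow> a (Suc k) = b (Suc k)" "k \<le> m"
  shows "a k = b k"
  using assms(4)
proof (induction k)
  case (Suc k)
  show ?case
  proof (cases "k \<in> changes a m")
    case False
    then have "k \<notin> changes b m" using assms(2) by simp
    with False Suc show ?thesis by (simp add: changes_def)
  qed (rule assms(3))
qed (rule assms(1))

lemma card_le_card_if_disjoint_family_meets:
  assumes "finite X" "disjoint_family_on R E" "\<And>k. k \<in> E \<Longrightarrow> R k \<inter> X \<noteq> {}"
  shows "card E \<le> card X"
proof -
  define c where "c k = (SOME x. x \<in> R k \<inter> X)" for k
  have c: "c k \<in> R k \<inter> X" if "k \<in> E" for k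
    unfolding c_def by (rule someI_ex) (use assms(3)[OF that] in blast)
  have "inj_on c E"
    using c assms(2) by (fastforce simp: inj_on_def disjoint_family_on_def)
  moreover have "c ` E \<subseteq> X"
    using c by blast
  ultimately show ?thesis
    using assms(1) by (rule card_inj_on_le)
qed

lemma card_subsets_card_le:
  assumes "finite A" "t \<le> card A"
  shows "card {Z. Z \<subseteq> A \<and> card Z \<le> t} \<le> (t + 1) * card A ^ t"
proof -
  have "{Z. Z \<subseteq> A \<and> card Z \<le> t} = (\<Union>j\<le>t. {Z. Z \<subseteq> A \<and> card Z = j})"
    by auto
  then have "card {Z. Z \<subseteq> A \<and> card Z \<le> t} \<le> (\<Sum>j\<le>t. card {Z. Z \<subseteq> A \<and> card Z = j})"
    by (simp add: card_UN_le)
  also have "\<dots> = (\<Sum>j\<le>t. card A choose j)"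
    using assms(1) by (simp add: n_subsets)
  also have "\<dots> \<le> (\<Sum>j\<le>t. card A ^ t)"
  proof (rule sum_mono)
    fix j
    assume "j \<in> {..t}"
    then have "card A choose j \<le> card A ^ j"
      using assms(2) by (intro binomial_le_pow) simp
    also have "\<dots> \<le> card A ^ t"
      using \<open>j \<in> {..t}\<close> assms(2) by (cases "card A") (auto intro: power_increasing)
    finally show "card A choose j \<le> card A ^ t" .
  qed
  finally show ?thesis
    by simp
qed

definition subsets_with_class_bounds :: "'a set \<Rightarrow> ('a \<Rightarrow> 'b) \<Rightarrow> 'b set \<Rightarrow> ('b \<Rightarrow> nat) \<Rightarrow> 'a set set" where
  "subsets_with_class_bounds A g I t =
     {E. E \<subseteq> A \<and> g ` E \<subseteq> I \<and> (\<forall>i\<in>I. card {x\<in>E. g x = i} \<le> t i)}"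

lemma card_subsets_with_class_bounds_le:
  assumes "finite A" "finite I" "\<And>i. i \<in> I \<Longrightarrow> t i \<le> card {x\<in>A. g x = i}"
  shows "card (subsets_with_class_bounds A g I t) \<le> (\<Prod>i\<in>I. (t i + 1) * card {x\<in>A. g x = i} ^ t i)"
proof -
  define Y where "Y i = {Z. Z \<subseteq> {x\<in>A. g x = i} \<and> card Z \<le> t i}" for i
  define h where "h E = restrict (\<lambda>i. {x\<in>E. g x = i}) I" for E
  have "inj_on h (subsets_with_class_bounds A g I t)"
  proof (rule inj_onI)
    fix E E'
    assume "E \<in> subsets_with_class_bounds A g I t" "E' \<in> subsets_with_class_bounds A g I t"
      and h_eq: "h E = h E'"
    then have I: "g ` (E \<union> E') \<subseteq> I"
      by (simp add: subsets_with_class_bounds_def image_Un)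
    have classes_eq: "{x\<in>E. g x = i} = {x\<in>E'. g x = i}" if "i \<in> I" for i
      using fun_cong[OF h_eq, of i] that by (simp add: h_def)
    have "x \<in> E \<longleftrightarrow> x \<in> E'" if "x \<in> E \<union> E'" for x
    proof -
      have "g x \<in> I"
        using I that by blast
      from classes_eq[OF this, unfolded set_eq_iff, rule_format, of x] show ?thesis
        by simp
    qed
    then show "E = E'"
      by blast
  qed
  moreover have "h ` subsets_with_class_bounds A g I t \<subseteq> (\<Pi>\<^sub>E i\<in>I. Y i)"
    by (auto simp: subsets_with_class_bounds_def h_def Y_def)
  moreover have "finite (\<Pi>\<^sub>E i\<in>I. Y i)"
    using assms(1,2) by (intro finite_PiE) (auto simp: Y_def)
  ultimately have "card (subsets_with_class_bounds A g I t) \<le> card (\<Pi>\<^sub>E i\<in>I. Y i)"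
    by (rule card_inj_on_le)
  also have "\<dots> = (\<Prod>i\<in>I. card (Y i))"
    using assms(2) by (rule card_PiE)
  also have "\<dots> \<le> (\<Prod>i\<in>I. (t i + 1) * card {x\<in>A. g x = i} ^ t i)"
    unfolding Y_def using assms(1,3) by (intro prod_mono conjI card_subsets_card_le) auto
  finally show ?thesis .
qed

lemma card_Sigma_PiE_le:
  assumes "finite \<E>" "\<And>E. E \<in> \<E> \<Longrightarrow> finite E \<and> card E \<le> r" "finite Q" "Q \<noteq> {}"
  shows "card (SIGMA E:\<E>. E \<rightarrow>\<^sub>E Q) \<le> card \<E> * card Q ^ r"
proof -
  have "card (SIGMA E:\<E>. E \<rightarrow>\<^sub>E Q) = (\<Sum>E\<in>\<E>. card (E \<rightarrow>\<^sub>E Q))"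
    using assms by (intro card_SigmaI) (auto intro: finite_PiE)
  also have "\<dots> = (\<Sum>E\<in>\<E>. card Q ^ card E)"
    using assms(2) by (intro sum.cong) (simp_all add: card_PiE)
  also have "\<dots> \<le> (\<Sum>E\<in>\<E>. card Q ^ r)"
    using assms by (intro sum_mono power_increasing) (simp_all add: Suc_le_eq card_gt_0_iff)
  finally show ?thesis
    by simp
qed

definition bounded_lists :: "nat \<Rightarrow> nat list set" where
  "bounded_lists r = {xs. set xs \<subseteq> {..r} \<and> length xs \<le> r}"

lemma finite_bounded_lists: "finite (bounded_lists r)"
  unfolding bounded_lists_def by (rule finite_subset[OF _ finite_lists_length_le[of "{..r}" r]]) auto

lemma bounded_lists_nonempty: "bounded_lists r \<noteq> {}"
proof -
  have "[] \<in> bounded_lists r"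
    by (simp add: bounded_lists_def)
  then show ?thesis
    by blast
qed

lemma positive_list_in_bounded_lists:
  fixes xs :: "nat list"
  assumes "\<forall>x\<in>set xs. 0 < x" "sum_list xs \<le> r"
  shows "xs \<in> bounded_lists r"
proof -
  have "length xs \<le> sum_list xs"
    using assms(1) by (induction xs) auto
  moreover have "set xs \<subseteq> {..r}"
    using assms(2) member_le_sum_list by fastforce
  ultimately show ?thesis
    using assms(2) by (simp add: bounded_lists_def)
qed

lemma one_plus_of_nat_le_two_power: "1 + real m \<le> 2 ^ m"
proof -
  have "Suc m \<le> 2 ^ m"
    using less_exp[of m] by linarith
  then have "real (Suc m) \<le> real (2 ^ m)"
    by (simp only: of_nat_le_iff)
  then show ?thesis
    by simp
qed

section \<open>Cycle counts\<close>

lemma cycles_of_eq_image: "cycles_of \<sigma> n = orb \<sigma> ` {..<n}"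
  unfolding cycles_of_def by auto

lemma finite_cycles_of: "finite (cycles_of \<sigma> n)"
  by (simp add: cycles_of_eq_image)

lemma fcyc_le: "fcyc \<sigma> n i \<le> n"
proof -
  have "fcyc \<sigma> n i \<le> card (cycles_of \<sigma> n)"
    unfolding fcyc_def by (rule card_mono[OF finite_cycles_of]) blast
  also have "\<dots> \<le> n"
    using card_image_le[of "{..<n}" "orb \<sigma>"] by (simp add: cycles_of_eq_image)
  finally show ?thesis .
qed

lemma card_nth_eq_count_mset: "card {k. k < length xs \<and> xs ! k = i} = count (mset xs) i"
  by (simp add: count_mset count_list_eq_length_filter length_filter_conv_card eq_commute)

lemma card_cycle_type_nth_eq_fcyc:
  "card {k. k < length (cycle_type \<sigma> n) \<and> cycle_type \<sigma> n ! k = i} = fcyc \<sigma> n i"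
proof -
  let ?C = "cycles_of \<sigma> n"
  have "card {k. k < length (cycle_type \<sigma> n) \<and> cycle_type \<sigma> n ! k = i}
      = count (image_mset card (mset_set ?C)) i"
    by (simp add: card_nth_eq_count_mset cycle_type_def)
  also have "\<dots> = (\<Sum>c\<in>card -` {i} \<inter> ?C. 1)"
    using finite_cycles_of by (simp add: count_image_mset)
  also have "\<dots> = card {c\<in>?C. card c = i}"
    by (simp add: Int_commute vimage_def Collect_conj_eq)
  finally show ?thesis
    by (simp add: fcyc_def)
qed

lemma fcyc_powr_le: "real (fcyc \<sigma> n i) powr (1 / real i) \<le> real n"
proof (cases "fcyc \<sigma> n i = 0 \<or> i = 0")
  case True
  then show ?thesis
    using fcyc_le[of \<sigma> n i] by auto
next
  case False
  then have "real (fcyc \<sigma> n i) powr (1 / real i) \<le> real (fcyc \<sigma> n i) powr 1"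
    by (intro powr_mono) auto
  then show ?thesis
    using fcyc_le[of \<sigma> n i] False by simp
qed

lemma bdd_above_fcyc_powr: "bdd_above ((\<lambda>i. real (fcyc \<sigma> n i) powr (1 / real i)) ` A)"
  using fcyc_powr_le by (intro bdd_aboveI2) blast

lemma fcyc_powr_le_Gfun: "2 \<le> i \<Longrightarrow> real (fcyc \<sigma> n i) powr (1 / real i) \<le> Gfun \<sigma> n"
  unfolding Gfun_def by (rule cSUP_upper[OF _ bdd_above_fcyc_powr]) simp

lemma Gfun_nonneg: "0 \<le> Gfun \<sigma> n"
  by (rule order.trans[OF powr_ge_zero fcyc_powr_le_Gfun[of 2]]) simp

lemma Gfun_le_Mfun: "Gfun \<sigma> n \<le> Mfun \<sigma> n"
  unfolding Gfun_def Mfun_def by (rule cSUP_subset_mono) (auto intro: bdd_above_fcyc_powr)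

lemma fcyc_one_le_Mfun: "real (fcyc \<sigma> n 1) \<le> Mfun \<sigma> n"
  using cSUP_upper[OF _ bdd_above_fcyc_powr, of 1 "{1..}" \<sigma> n] by (simp add: Mfun_def)

lemma fcyc_le_Gfun_power:
  assumes "2 \<le> i"
  shows "real (fcyc \<sigma> n i) \<le> Gfun \<sigma> n ^ i"
proof -
  have "real (fcyc \<sigma> n i) = (real (fcyc \<sigma> n i) powr (1 / real i)) ^ i"
    using assms by (cases "fcyc \<sigma> n i = 0") (simp_all flip: powr_realpow add: powr_powr)
  also have "\<dots> \<le> Gfun \<sigma> n ^ i"
    using fcyc_powr_le_Gfun[OF assms] by (intro power_mono) auto
  finally show ?thesis .
qed

lemma prod_fcyc_power_le_Gfun_power:
  "(\<Prod>i\<in>{2..K}. real (t i + 1) * real (fcyc \<sigma> n i) ^ t i)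
    \<le> 2 ^ (\<Sum>i\<in>{2..K}. t i) * Gfun \<sigma> n ^ (\<Sum>i\<in>{2..K}. i * t i)"
proof -
  have "(\<Prod>i\<in>{2..K}. real (t i + 1) * real (fcyc \<sigma> n i) ^ t i)
      \<le> (\<Prod>i\<in>{2..K}. 2 ^ t i * Gfun \<sigma> n ^ (i * t i))"
  proof (rule prod_mono)
    fix i
    assume "i \<in> {2..K}"
    then have "real (fcyc \<sigma> n i) ^ t i \<le> Gfun \<sigma> n ^ (i * t i)"
      by (simp add: power_mult power_mono fcyc_le_Gfun_power)
    then show "0 \<le> real (t i + 1) * real (fcyc \<sigma> n i) ^ t i \<and>
        real (t i + 1) * real (fcyc \<sigma> n i) ^ t i \<le> 2 ^ t i * Gfun \<sigma> n ^ (i * t i)"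
      using one_plus_of_nat_le_two_power[of "t i"] by (simp add: mult_mono)
  qed
  also have "\<dots> = 2 ^ (\<Sum>i\<in>{2..K}. t i) * Gfun \<sigma> n ^ (\<Sum>i\<in>{2..K}. i * t i)"
    by (simp add: prod.distrib power_sum)
  finally show ?thesis .
qed

lemma fcyc_one_power_mult_Gfun_power_le:
  assumes "K \<le> r"
  shows "real (fcyc \<sigma> n 1) ^ (r - K) * Gfun \<sigma> n ^ K \<le> Mfun \<sigma> n ^ r"
proof -
  have "real (fcyc \<sigma> n 1) ^ (r - K) * Gfun \<sigma> n ^ K \<le> Mfun \<sigma> n ^ (r - K) * Mfun \<sigma> n ^ K"
    using fcyc_one_le_Mfun[of \<sigma> n] Gfun_le_Mfun[of \<sigma> n] Gfun_nonneg[of \<sigma> n]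
    by (intro mult_mono power_mono zero_le_power) auto
  then show ?thesis
    using assms by (simp flip: power_add)
qed

section \<open>Counting the tableaux\<close>

lemma card_lower_skew:
  assumes "diag mu \<subseteq> diag lam"
  shows "card (lower_skew lam mu) + card (diag mu \<inter> lower_rows) = sum_list (tl lam)"
proof -
  have sub: "diag mu \<inter> lower_rows \<subseteq> diag lam \<inter> lower_rows"
    using assms by blast
  have "lower_skew lam mu = diag lam \<inter> lower_rows - diag mu \<inter> lower_rows"
    by (auto simp: lower_skew_eq)
  then show ?thesis
    using card_Diff_subset[OF _ sub] card_mono[OF _ sub] by (simp add: card_diag_Int_lower_rows)
qed

lemma card_tail_changes_le:
  assumes T: "ribbon_tableau lam alpha T"
  shows "card (changes (\<lambda>k. tl (T ! k)) (length alpha)) \<le> sum_list (tl lam)"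
proof -
  have "card (changes (\<lambda>k. tl (T ! k)) (length alpha)) \<le> card (diag lam \<inter> lower_rows)"
  proof (rule card_le_card_if_disjoint_family_meets)
    show "disjoint_family_on (rib T) (changes (\<lambda>k. tl (T ! k)) (length alpha))"
      using disjoint_family_on_rib[OF T] by (rule disjoint_family_on_mono[rotated]) (auto simp: changes_def)
    fix k
    assume "k \<in> changes (\<lambda>k. tl (T ! k)) (length alpha)"
    then show "rib T k \<inter> (diag lam \<inter> lower_rows) \<noteq> {}"
      using rib_meets_lower_rows_if_tl_changes[OF T] rib_subset_diag[OF T] by (fastforce simp: changes_def)
  qed simp
  then show ?thesis
    by (simp add: card_diag_Int_lower_rows)
qed

lemma S_set_ribbon_tableau: "T \<in> S_set lam alpha mu s \<Longrightarrow> ribbon_tableau lam alpha T"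
  by (simp add: S_set_def)

lemma card_S_set_class:
  "T \<in> S_set lam alpha mu s \<Longrightarrow> 2 \<le> i \<Longrightarrow>
    card {k. k < length alpha \<and> alpha ! k = i \<and> rib T k \<inter> lower_skew lam mu \<noteq> {}} = s i"
  by (simp add: S_set_def)

lemma rib_subset_diag_if_one:
  "T \<in> S_set lam alpha mu s \<Longrightarrow> k < length alpha \<Longrightarrow> alpha ! k = 1 \<Longrightarrow> rib T k \<subseteq> diag mu"
  unfolding S_set_def by blast

lemma rib_disjoint_diag_if_not_one:
  assumes T: "T \<in> S_set lam alpha mu s" and k: "k < length alpha" "alpha ! k \<noteq> 1"
  shows "rib T k \<inter> diag mu = {}"
proof -
  have "rib T k \<inter> rib T j = {}" if "j < length alpha" "alpha ! j = 1" for j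
  proof -
    have "k \<noteq> j"
      using that k(2) by auto
    then show ?thesis
      using disjoint_family_on_rib[OF S_set_ribbon_tableau[OF T]] k(1) that(1)
      unfolding disjoint_family_on_def by blast
  qed
  moreover have "diag mu = \<Union>{rib T j | j. j < length alpha \<and> alpha ! j = 1}"
    using T by (simp add: S_set_def)
  ultimately show ?thesis
    by blast
qed

lemma card_tail_changes_one_le:
  assumes T: "T \<in> S_set lam alpha mu s"
  shows "card {k \<in> changes (\<lambda>k. tl (T ! k)) (length alpha). alpha ! k = 1} \<le> card (diag mu \<inter> lower_rows)"
proof (rule card_le_card_if_disjoint_family_meets)
  have "disjoint_family_on (rib T) {..<length alpha}"
    using disjoint_family_on_rib S_set_ribbon_tableau[OF T] by blast
  then show "disjoint_family_on (rib T) {k \<in> changes (\<lambda>k. tl (T ! k)) (length alpha). alpha ! k = 1}"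
    by (rule disjoint_family_on_mono[rotated]) (auto simp: changes_def)
  fix k
  assume "k \<in> {k \<in> changes (\<lambda>k. tl (T ! k)) (length alpha). alpha ! k = 1}"
  then show "rib T k \<inter> (diag mu \<inter> lower_rows) \<noteq> {}"
    using rib_meets_lower_rows_if_tl_changes[OF S_set_ribbon_tableau[OF T]] rib_subset_diag_if_one[OF T]
    by (fastforce simp: changes_def)
qed simp

lemma tail_change_meets_lower_skew:
  assumes T: "T \<in> S_set lam alpha mu s"
    and k: "k \<in> changes (\<lambda>k. tl (T ! k)) (length alpha)" "alpha ! k \<noteq> 1"
  shows "rib T k \<inter> lower_skew lam mu \<noteq> {}"
proof -
  have "k < length alpha" "tl (T ! Suc k) \<noteq> tl (T ! k)"
    using k by (simp_all add: changes_def)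
  then show ?thesis
    using rib_meets_lower_rows_if_tl_changes[OF S_set_ribbon_tableau[OF T]]
      rib_subset_diag[OF S_set_ribbon_tableau[OF T]] rib_disjoint_diag_if_not_one[OF T _ k(2)]
    by (fastforce simp: lower_skew_eq)
qed

lemma tail_changes_in_subsets_with_class_bounds:
  fixes lam mu :: "nat list"
  defines "r \<equiv> sum_list (tl lam)" and "K \<equiv> card (lower_skew lam mu)"
  assumes T: "T \<in> S_set lam alpha mu s" and mu: "diag mu \<subseteq> diag lam"
    and "1 \<le> K" and s_zero: "\<forall>i>K. s i = 0"
  shows "changes (\<lambda>k. tl (T ! k)) (length alpha)
    \<in> subsets_with_class_bounds {..<length alpha} ((!) alpha) {1..K} (\<lambda>i. if i = 1 then r - K else s i)"
proof -
  define D where "D = changes (\<lambda>k. tl (T ! k)) (length alpha)"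
  define meets where
    "meets i = {k. k < length alpha \<and> alpha ! k = i \<and> rib T k \<inter> lower_skew lam mu \<noteq> {}}" for i
  have D_meets: "k \<in> meets (alpha ! k)" if "k \<in> D" "alpha ! k \<noteq> 1" for k
    using that tail_change_meets_lower_skew[OF T] by (auto simp: D_def meets_def changes_def)
  have card_meets: "card (meets i) = s i" if "2 \<le> i" for i
    using card_S_set_class[OF T that] by (simp add: meets_def)
  have "alpha ! k \<in> {1..K}" if "k \<in> D" for k
  proof -
    have "0 < alpha ! k"
      using that ribbon_tableau_weight_pos[OF S_set_ribbon_tableau[OF T]] by (simp add: D_def changes_def)
    moreover have "alpha ! k \<le> K" if "alpha ! k \<noteq> 1"
    proof (rule ccontr)
      assume "\<not> alpha ! k \<le> K"
      then have "meets (alpha ! k) = {}"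
        using card_meets[of "alpha ! k"] s_zero \<open>1 \<le> K\<close> by (simp add: meets_def)
      then show False
        using D_meets \<open>k \<in> D\<close> that by blast
    qed
    ultimately show ?thesis
      using \<open>1 \<le> K\<close> by (cases "alpha ! k = 1") auto
  qed
  moreover have "card {k \<in> D. alpha ! k = 1} \<le> r - K"
    using card_tail_changes_one_le[OF T] card_lower_skew[OF mu] by (simp add: D_def r_def K_def)
  moreover have "card {k \<in> D. alpha ! k = i} \<le> s i" if "2 \<le> i" for i
  proof -
    have "{k \<in> D. alpha ! k = i} \<subseteq> meets i"
      using D_meets that by auto
    then show ?thesis
      using card_meets[OF that] card_mono[of "meets i"] by (simp add: meets_def)
  qed
  ultimately show ?thesis
    by (auto simp: D_def changes_def subsets_with_class_bounds_def)
qed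

lemma tl_ribbon_tableau_nth_in_bounded_lists:
  assumes "ribbon_tableau lam alpha T" "k \<le> length alpha"
  shows "tl (T ! k) \<in> bounded_lists (sum_list (tl lam))"
proof (rule positive_list_in_bounded_lists)
  show "\<forall>x\<in>set (tl (T ! k)). 0 < x"
    using is_partition_tl[OF ribbon_tableau_is_partition[OF assms]] by (simp add: is_partition_def)
  show "sum_list (tl (T ! k)) \<le> sum_list (tl lam)"
    by (rule sum_list_tl_ribbon_tableau_nth_le[OF assms])
qed

lemma ribbon_tableau_eq_if_tail_changes_eq:
  assumes T: "ribbon_tableau lam alpha T" and T': "ribbon_tableau lam alpha T'"
    and changes_eq: "changes (\<lambda>k. tl (T ! k)) (length alpha) = changes (\<lambda>k. tl (T' ! k)) (length alpha)"
    and tl_Suc_eq: "\<And>k. k \<in> changes (\<lambda>k. tl (T ! k)) (length alpha) \<Longrightarrow> tl (T ! Suc k) = tl (T' ! Suc k)"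
  shows "T = T'"
proof (rule ribbon_tableau_eqI[OF T T'])
  fix k
  assume k: "k \<le> length alpha"
  show "tl (T ! k) = tl (T' ! k)"
  proof (rule eq_if_changes_eq[where a = "\<lambda>k. tl (T ! k)" and b = "\<lambda>k. tl (T' ! k)",
        OF _ changes_eq tl_Suc_eq k])
    show "tl (T ! 0) = tl (T' ! 0)"
      using T T' by (simp add: ribbon_tableau_def)
  qed
qed

lemma card_S_set_le:
  fixes lam mu :: "nat list"
  defines "r \<equiv> sum_list (tl lam)" and "K \<equiv> card (lower_skew lam mu)"
  assumes mu: "diag mu \<subseteq> diag lam" and K: "1 \<le> K" and s_zero: "\<forall>i>K. s i = 0"
  shows "card (S_set lam alpha mu s) \<le> card (bounded_lists r) ^ r *
    card (subsets_with_class_bounds {..<length alpha} ((!) alpha) {1..K} (\<lambda>i. if i = 1 then r - K else s i))"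
proof -
  define S where "S = S_set lam alpha mu s"
  define \<E>\<^sub>0 where "\<E>\<^sub>0 =
    subsets_with_class_bounds {..<length alpha} ((!) alpha) {1..K} (\<lambda>i. if i = 1 then r - K else s i)"
  define \<E> where "\<E> = {E \<in> \<E>\<^sub>0. card E \<le> r}"
  define D where "D T = changes (\<lambda>k. tl (T ! k)) (length alpha)" for T :: "nat list list"
  define \<Phi> where "\<Phi> T = (D T, restrict (\<lambda>k. tl (T ! Suc k)) (D T))" for T
  have fin_\<E>\<^sub>0: "finite \<E>\<^sub>0"
    by (rule finite_subset[of _ "Pow {..<length alpha}"]) (auto simp: \<E>\<^sub>0_def subsets_with_class_bounds_def)
  have fin_E: "finite E" if "E \<in> \<E>" for E
    using that finite_subset[of E "{..<length alpha}"]
    by (simp add: \<E>_def \<E>\<^sub>0_def subsets_with_class_bounds_def)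
  have "\<Phi> ` S \<subseteq> (SIGMA E:\<E>. E \<rightarrow>\<^sub>E bounded_lists r)"
  proof (rule image_subsetI)
    fix T
    assume "T \<in> S"
    then have T: "ribbon_tableau lam alpha T"
      by (simp add: S_def S_set_ribbon_tableau)
    have "D T \<in> \<E>"
      using tail_changes_in_subsets_with_class_bounds[OF \<open>T \<in> S\<close>[unfolded S_def] mu] K s_zero
        card_tail_changes_le[OF T] unfolding \<E>_def \<E>\<^sub>0_def D_def r_def K_def by simp
    moreover have "tl (T ! Suc k) \<in> bounded_lists r" if "k \<in> D T" for k
      using that tl_ribbon_tableau_nth_in_bounded_lists[OF T] by (simp add: D_def changes_def r_def)
    ultimately show "\<Phi> T \<in> (SIGMA E:\<E>. E \<rightarrow>\<^sub>E bounded_lists r)"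
      by (simp add: \<Phi>_def)
  qed
  moreover have "inj_on \<Phi> S"
  proof (rule inj_onI)
    fix T T'
    assume "T \<in> S" "T' \<in> S" and \<Phi>_eq: "\<Phi> T = \<Phi> T'"
    then have T: "ribbon_tableau lam alpha T" and T': "ribbon_tableau lam alpha T'"
      by (simp_all add: S_def S_set_ribbon_tableau)
    have D_eq: "D T = D T'"
      and tails_eq: "restrict (\<lambda>k. tl (T ! Suc k)) (D T) = restrict (\<lambda>k. tl (T' ! Suc k)) (D T')"
      using \<Phi>_eq[unfolded \<Phi>_def prod.inject] by blast+
    show "T = T'"
    proof (rule ribbon_tableau_eq_if_tail_changes_eq[OF T T'])
      fix k
      assume "k \<in> changes (\<lambda>k. tl (T ! k)) (length alpha)"
      then show "tl (T ! Suc k) = tl (T' ! Suc k)"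
        using fun_cong[OF tails_eq, of k] D_eq by (simp add: D_def)
    qed (use D_eq in \<open>simp add: D_def\<close>)
  qed
  moreover have "finite (SIGMA E:\<E>. E \<rightarrow>\<^sub>E bounded_lists r)"
  proof (rule finite_SigmaI)
    show "finite \<E>"
      using fin_\<E>\<^sub>0 by (simp add: \<E>_def)
  qed (simp add: fin_E finite_bounded_lists finite_PiE)
  ultimately have "card S \<le> card (SIGMA E:\<E>. E \<rightarrow>\<^sub>E bounded_lists r)"
    by (intro card_inj_on_le)
  also have "\<dots> \<le> card \<E> * card (bounded_lists r) ^ r"
    using fin_\<E>\<^sub>0 fin_E finite_bounded_lists bounded_lists_nonempty
    by (intro card_Sigma_PiE_le) (simp_all add: \<E>_def)
  also have "\<dots> \<le> card \<E>\<^sub>0 * card (bounded_lists r) ^ r"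
    using fin_\<E>\<^sub>0 by (simp add: \<E>_def card_mono)
  finally show ?thesis
    by (simp add: S_def \<E>\<^sub>0_def mult.commute)
qed

lemma s_le_card_weight_class:
  assumes "T \<in> S_set lam alpha mu s" "2 \<le> i"
  shows "s i \<le> card {k. k < length alpha \<and> alpha ! k = i}"
proof -
  have "{k. k < length alpha \<and> alpha ! k = i \<and> rib T k \<inter> lower_skew lam mu \<noteq> {}}
      \<subseteq> {k. k < length alpha \<and> alpha ! k = i}"
    by blast
  from card_mono[OF _ this] show ?thesis
    using card_S_set_class[OF assms] by simp
qed

lemma card_S_set_cycle_type_le_prod:
  fixes lam mu :: "nat list"
  defines "r \<equiv> sum_list (tl lam)" and "K \<equiv> card (lower_skew lam mu)"
  assumes mu: "diag mu \<subseteq> diag lam" and K: "1 \<le> K" and s_zero: "\<forall>i>K. s i = 0"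
    and f: "r - K \<le> fcyc \<sigma> n 1"
  shows "card (S_set lam (cycle_type \<sigma> n) mu s) \<le> card (bounded_lists r) ^ r *
    ((r - K + 1) * fcyc \<sigma> n 1 ^ (r - K) * (\<Prod>i\<in>{2..K}. (s i + 1) * fcyc \<sigma> n i ^ s i))"
proof (cases "S_set lam (cycle_type \<sigma> n) mu s = {}")
  case False
  then obtain T where T: "T \<in> S_set lam (cycle_type \<sigma> n) mu s"
    by blast
  define t where "t = (\<lambda>i. if i = 1 then r - K else s i)"
  have t_le: "t i \<le> card {k \<in> {..<length (cycle_type \<sigma> n)}. cycle_type \<sigma> n ! k = i}"
    if "i \<in> {1..K}" for i
    using that f s_le_card_weight_class[OF T, of i]
    by (cases "i = 1") (simp_all add: t_def card_cycle_type_nth_eq_fcyc)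
  have "card (S_set lam (cycle_type \<sigma> n) mu s) \<le> card (bounded_lists r) ^ r *
      card (subsets_with_class_bounds {..<length (cycle_type \<sigma> n)} ((!) (cycle_type \<sigma> n)) {1..K} t)"
    unfolding t_def by (rule card_S_set_le[OF mu, folded r_def K_def, OF K s_zero])
  also have "\<dots> \<le> card (bounded_lists r) ^ r * (\<Prod>i\<in>{1..K}. (t i + 1) * fcyc \<sigma> n i ^ t i)"
    using card_subsets_with_class_bounds_le[OF finite_lessThan finite_atLeastAtMost t_le]
    by (simp add: card_cycle_type_nth_eq_fcyc)
  also have "{1..K} = insert 1 {2..K}"
    using K by auto
  finally show ?thesis
    by (simp add: t_def)
qed simp

lemma card_S_set_cycle_type_le:
  fixes lam mu :: "nat list"
  defines "r \<equiv> sum_list (tl lam)" and "K \<equiv> card (lower_skew lam mu)"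
  assumes mu: "diag mu \<subseteq> diag lam" and K: "1 \<le> K" and s_zero: "\<forall>i>K. s i = 0"
    and s_sum: "(\<Sum>i=2..K. i * s i) = K" and f: "r - K \<le> fcyc \<sigma> n 1"
  shows "real (card (S_set lam (cycle_type \<sigma> n) mu s))
    \<le> real ((2 * card (bounded_lists r)) ^ r) * real (fcyc \<sigma> n 1) ^ (r - K) * Gfun \<sigma> n ^ K"
proof -
  define c where "c = real (card (bounded_lists r))"
  define f where "f = real (fcyc \<sigma> n 1)"
  have "K \<le> r"
    using card_lower_skew[OF mu] by (simp add: r_def K_def)
  have "(\<Sum>i\<in>{2..K}. s i) \<le> (\<Sum>i\<in>{2..K}. i * s i)"
    by (intro sum_mono) simp
  then have "(r - K) + (\<Sum>i\<in>{2..K}. s i) \<le> r"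
    using \<open>K \<le> r\<close> s_sum by simp
  then have two_powers: "(2::real) ^ (r - K) * 2 ^ (\<Sum>i\<in>{2..K}. s i) \<le> 2 ^ r"
    by (simp flip: power_add)
  have "real (card (S_set lam (cycle_type \<sigma> n) mu s)) \<le> real (card (bounded_lists r) ^ r *
      ((r - K + 1) * fcyc \<sigma> n 1 ^ (r - K) * (\<Prod>i\<in>{2..K}. (s i + 1) * fcyc \<sigma> n i ^ s i)))"
    using card_S_set_cycle_type_le_prod[OF mu, folded r_def K_def, OF K s_zero f]
    by (simp only: of_nat_le_iff)
  also have "\<dots> = c ^ r *
      (real (r - K + 1) * f ^ (r - K) * (\<Prod>i\<in>{2..K}. real (s i + 1) * real (fcyc \<sigma> n i) ^ s i))"
    by (simp only: c_def f_def of_nat_mult of_nat_power of_nat_prod)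
  also have "\<dots> \<le> c ^ r * (2 ^ (r - K) * f ^ (r - K) * (2 ^ (\<Sum>i\<in>{2..K}. s i) * Gfun \<sigma> n ^ K))"
  proof (intro mult_left_mono mult_mono mult_right_mono)
    show "real (r - K + 1) \<le> 2 ^ (r - K)"
      using one_plus_of_nat_le_two_power[of "r - K"] by simp
    show "(\<Prod>i\<in>{2..K}. real (s i + 1) * real (fcyc \<sigma> n i) ^ s i)
        \<le> 2 ^ (\<Sum>i\<in>{2..K}. s i) * Gfun \<sigma> n ^ K"
      using prod_fcyc_power_le_Gfun_power[of s \<sigma> n K] s_sum by simp
  qed (simp_all add: c_def f_def prod_nonneg)
  also have "\<dots> = (c ^ r * f ^ (r - K) * Gfun \<sigma> n ^ K) * (2 ^ (r - K) * 2 ^ (\<Sum>i\<in>{2..K}. s i))"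
    by (simp only: mult_ac)
  also have "\<dots> \<le> (c ^ r * f ^ (r - K) * Gfun \<sigma> n ^ K) * 2 ^ r"
    by (rule mult_left_mono[OF two_powers]) (simp add: c_def f_def Gfun_nonneg)
  finally show ?thesis
    by (simp add: c_def f_def power_mult_distrib mult.commute mult.left_commute)
qed

theorem lemma2p10:
  fixes r :: nat
  assumes "1 \<le> r"
  shows "\<exists>C :: real. \<forall>n lam \<sigma> mu s.
    3 * r \<le> n \<longrightarrow> partition_of lam n \<longrightarrow> n - first_row lam = r \<longrightarrow>
    \<sigma> permutes {..<n} \<longrightarrow> 2 * r \<le> fcyc \<sigma> n 1 \<longrightarrow>
    partition_of mu (fcyc \<sigma> n 1) \<longrightarrow> diag mu \<subseteq> diag lam \<longrightarrow>
    2 \<le> card (lower_skew lam mu) \<longrightarrow>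
    (\<forall>i>card (lower_skew lam mu). s i = 0) \<longrightarrow>
    (\<Sum>i=2..card (lower_skew lam mu). i * s i) = card (lower_skew lam mu) \<longrightarrow>
    real (card (S_set lam (cycle_type \<sigma> n) mu s))
      \<le> C * real (fcyc \<sigma> n 1) powi (int r - int (card (lower_skew lam mu)))
          * Gfun \<sigma> n ^ card (lower_skew lam mu)
    \<and> C * real (fcyc \<sigma> n 1) powi (int r - int (card (lower_skew lam mu)))
          * Gfun \<sigma> n ^ card (lower_skew lam mu) \<le> C * Mfun \<sigma> n ^ r"
proof -
  define C where "C = real ((2 * card (bounded_lists r)) ^ r)"
  show ?thesis
  proof (rule exI[of _ C], intro allI impI)
    fix n lam \<sigma> mu s
    assume "3 * r \<le> n" and lam: "partition_of lam n" and lam_tail: "n - first_row lam = r"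
      and "\<sigma> permutes {..<n}" and f: "2 * r \<le> fcyc \<sigma> n 1"
      and "partition_of mu (fcyc \<sigma> n 1)" and mu: "diag mu \<subseteq> diag lam"
      and K: "2 \<le> card (lower_skew lam mu)" and s_zero: "\<forall>i>card (lower_skew lam mu). s i = 0"
      and s_sum: "(\<Sum>i=2..card (lower_skew lam mu). i * s i) = card (lower_skew lam mu)"
    define K where "K = card (lower_skew lam mu)"
    have r: "sum_list (tl lam) = r"
      using lam lam_tail by (simp add: partition_of_def sum_list_tl)
    have "K \<le> r"
      using card_lower_skew[OF mu] r by (simp add: K_def)
    then have "real (fcyc \<sigma> n 1) powi (int r - int K) = real (fcyc \<sigma> n 1) ^ (r - K)"
      by (simp flip: of_nat_diff)
    moreover have "real (card (S_set lam (cycle_type \<sigma> n) mu s))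
        \<le> C * real (fcyc \<sigma> n 1) ^ (r - K) * Gfun \<sigma> n ^ K"
      using card_S_set_cycle_type_le[OF mu, of s \<sigma> n] K s_zero s_sum f r
      by (simp add: C_def K_def)
    moreover have "C * real (fcyc \<sigma> n 1) ^ (r - K) * Gfun \<sigma> n ^ K \<le> C * Mfun \<sigma> n ^ r"
      using fcyc_one_power_mult_Gfun_power_le[OF \<open>K \<le> r\<close>]
      by (simp add: C_def mult.assoc mult_left_mono)
    ultimately show "real (card (S_set lam (cycle_type \<sigma> n) mu s))
        \<le> C * real (fcyc \<sigma> n 1) powi (int r - int (card (lower_skew lam mu)))
          * Gfun \<sigma> n ^ card (lower_skew lam mu)
      \<and> C * real (fcyc \<sigma> n 1) powi (int r - int (card (lower_skew lam mu)))
          * Gfun \<sigma> n ^ card (lower_skew lam mu) \<le> C * Mfun \<sigma> n ^ r"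
      by (simp add: K_def)
  qed
qed

end
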